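(* If $A,B$ are algebras with no (non-zero) nilpotent elements and $\tau:B\to A$ is an $n$-transfer for the ring homomorphism $f:A\to B$, then $K_\tau=0$.
   Context: All algebras are commutative, associative, unital $\mathbb{C}$-algebras. For a linear map $f:A\to B$ and $n\ge1$, define $\Phi_n(f):A^{\otimes n}\to B$ by $\Phi_n(f)(a_1,\dots,a_n)=\sum_{\sigma\in\Sigma_n}\varepsilon_\sigma f_{\gamma_1}(a_1,\dots,a_n)\cdots f_{\gamma_r}(a_1,\dots,a_n)$, where $\sigma=\gamma_1\cdots\gamma_r$ is the decomposition into disjoint cycles of total length $n$ (cycles of length 1 included), $\varepsilon_\sigma$ is the sign of $\sigma$, and $f_\gamma(a_1,\dots,a_n)=f(a_{i_1}a_{i_2}\cdots a_{i_m})$ for a cycle $\gamma=(i_1\dots i_m)$. A linear map $f:A\to B$ is a Frobenius $n$-homomorphism if $f(1)=n$ and $\Phi_{n+1}(f)\equiv0$ (for $n=0$ this means $f=0$). Kernel of a Frobenius $n$-homomorphism $f:A\to B$: $K_f=\{a\in A: f(ax)=0\text{ for all }x\in A\}$. $n$-transfer: for a ring homomorphism $f:A\to B$, a linear map $\tau:B\to A$ is an $n$-transfer for $f$ if (i) $\tau$ is a Frobenius $n$-homomorphism; (ii) $\tau(f(a)b)=a\tau(b)$ for all $a\in A$, $b\in B$; (iii) $f\tau:B\to B$ is the sum of the identity and a Frobenius $(n-1)$-homomorphism $g:B\to B$. *)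

theory Defs
  imports Complex_Main "HOL-Combinatorics.Orbits"
begin

text \<open>
  Commutative, associative, unital algebras over the complex numbers.  The zero algebra is not
  excluded; this is why the class does not extend \<^class>\<open>comm_ring_1\<close>, which assumes \<open>0 \<noteq> 1\<close>.
\<close>

class complex_comm_algebra = comm_ring + comm_monoid_mult +
  fixes scaleC :: "complex \<Rightarrow> 'a \<Rightarrow> 'a" (infixr \<open>*\<^sub>C\<close> 75)
  assumes scaleC_add_right: "c *\<^sub>C (x + y) = c *\<^sub>C x + c *\<^sub>C y"
    and scaleC_add_left: "(c + d) *\<^sub>C x = c *\<^sub>C x + d *\<^sub>C x"
    and scaleC_scaleC: "c *\<^sub>C (d *\<^sub>C x) = (c * d) *\<^sub>C x"
    and scaleC_one: "1 *\<^sub>C x = x"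
    and mult_scaleC_left: "(c *\<^sub>C x) * y = c *\<^sub>C (x * y)"

lemma vector_space_scaleC:
  "vector_space (scaleC :: complex \<Rightarrow> 'a::complex_comm_algebra \<Rightarrow> 'a)"
  by unfold_locales (simp_all add: scaleC_add_right scaleC_add_left scaleC_scaleC scaleC_one)

abbreviation complex_linear ::
  "('a::complex_comm_algebra \<Rightarrow> 'b::complex_comm_algebra) \<Rightarrow> bool" where
  "complex_linear \<equiv> Vector_Spaces.linear scaleC scaleC"

definition nilpotent :: "'a::complex_comm_algebra \<Rightarrow> bool" where
  "nilpotent x \<longleftrightarrow> (\<exists>k. x ^ k = 0)"

text \<open>Ring homomorphisms preserve \<open>1\<close>, but are not assumed to be \<open>\<complex>\<close>-linear.\<close>

definition ring_homomorphism ::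
  "('a::complex_comm_algebra \<Rightarrow> 'b::complex_comm_algebra) \<Rightarrow> bool" where
  "ring_homomorphism f \<longleftrightarrow>
     f 1 = 1 \<and> (\<forall>x y. f (x + y) = f x + f y) \<and> (\<forall>x y. f (x * y) = f x * f y)"

text \<open>
  A linear map on the \<open>n\<close>-th tensor power is given by its values on tuples
  \<open>(a 1, \<dots>, a n)\<close>; a tuple is a function on \<^typ>\<open>nat\<close> of which only the values on
  \<open>{1..n}\<close> matter.

  The cycles of a permutation \<open>\<sigma>\<close> of \<open>{1..n}\<close>, including those of length 1, are represented by
  their supports, the orbits of \<open>\<sigma>\<close>: by commutativity, \<open>f\<^sub>\<gamma>(a 1, \<dots>, a n)\<close> depends only on the
  set of indices that occur in \<open>\<gamma>\<close>.
\<close>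

definition cycle_supports :: "nat \<Rightarrow> (nat \<Rightarrow> nat) \<Rightarrow> nat set set" where
  "cycle_supports n \<sigma> = orbit \<sigma> ` {1..n}"

definition Phi ::
  "nat \<Rightarrow> ('a::complex_comm_algebra \<Rightarrow> 'b::complex_comm_algebra) \<Rightarrow> (nat \<Rightarrow> 'a) \<Rightarrow> 'b" where
  "Phi n f a =
     (\<Sum>\<sigma> | \<sigma> permutes {1..n}.
        of_int (sign \<sigma>) *\<^sub>C (\<Prod>\<gamma>\<in>cycle_supports n \<sigma>. f (\<Prod>i\<in>\<gamma>. a i)))"

text \<open>
  The integer \<open>n\<close> in the target algebra is written \<open>of_nat n *\<^sub>C 1\<close>, since \<^const>\<open>of_nat\<close> is only
  available in rings with \<open>0 \<noteq> 1\<close>.  For \<open>n = 0\<close> the definition says that \<open>f = 0\<close>.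
\<close>

definition frobenius_hom ::
  "nat \<Rightarrow> ('a::complex_comm_algebra \<Rightarrow> 'b::complex_comm_algebra) \<Rightarrow> bool" where
  "frobenius_hom n f \<longleftrightarrow>
     complex_linear f \<and> f 1 = of_nat n *\<^sub>C 1 \<and> (\<forall>a. Phi (n + 1) f a = 0)"

definition frobenius_kernel ::
  "('a::complex_comm_algebra \<Rightarrow> 'b::complex_comm_algebra) \<Rightarrow> 'a set" where
  "frobenius_kernel f = {a. \<forall>x. f (a * x) = 0}"

text \<open>
  The condition \<open>n \<ge> 1\<close> is needed for Frobenius \<open>(n - 1)\<close>-homomorphisms to make sense.
\<close>

definition n_transfer ::
  "nat \<Rightarrow> ('a::complex_comm_algebra \<Rightarrow> 'b::complex_comm_algebra) \<Rightarrow> ('b \<Rightarrow> 'a) \<Rightarrow> bool" where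
  "n_transfer n f \<tau> \<longleftrightarrow>
     n \<ge> 1 \<and>
     frobenius_hom n \<tau> \<and>
     (\<forall>a b. \<tau> (f a * b) = a * \<tau> b) \<and>
     (\<exists>g :: 'b \<Rightarrow> 'b. frobenius_hom (n - 1) g \<and> (\<forall>b. f (\<tau> b) = b + g b))"

end

theory Submission
  imports Defs "HOL-Combinatorics.Cycles"
begin

text \<open>
  If \<open>b\<close> lies in the kernel of \<open>\<tau>\<close>, then \<open>0 = f (\<tau> (b x)) = b x + g (b x)\<close>, so \<open>g\<close> acts as \<open>-1\<close>
  on the ideal generated by \<open>b\<close>.  As the sign of a permutation of \<open>n\<close> letters with \<open>r\<close> cycles is
  \<open>(-1)\<^sup>n\<^sup>-\<^sup>r\<close>, all summands of \<open>\<Phi>\<^sub>n(g)(b, \<dots>, b)\<close> are then equal to \<open>(-1)\<^sup>n b\<^sup>n\<close>.  Hence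
  \<open>n! b\<^sup>n = 0\<close>, and \<open>b\<close> is nilpotent.
\<close>

text \<open>A cycle of length k is a product of k - 1 transpositions; the exponent is written
  without subtraction on naturals.\<close>

lemma sign_cycle_of_list:
  assumes "cs \<noteq> []" "cycle cs"
  shows "sign (cycle_of_list cs) = - ((-1) ^ length cs)"
  using assms
proof (induction cs rule: cycle_of_list.induct)
  case (1 i j cs)
  then show ?case
    by (auto simp: sign_compose permutation_swap_id permutation_of_cycle sign_swap_id
        simp del: comp_apply)
qed simp_all

lemma cyclic_on_cycle_of_list:
  assumes "cs \<noteq> []" "cycle cs"
  shows "cyclic_on (cycle_of_list cs) (set cs)"
proof (rule cyclic_on_singleI)
  let ?c = "cycle_of_list cs"
  show "hd cs \<in> set cs"
    using assms(1) by simp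
  show "set cs = orbit ?c (hd cs)"
  proof
    show "orbit ?c (hd cs) \<subseteq> set cs"
      using assms(1) cycle_permutes by (intro permutes_orbit_subset) auto
    show "set cs \<subseteq> orbit ?c (hd cs)"
    proof
      fix x assume "x \<in> set cs"
      then obtain n where n: "n < length cs" "x = cs ! n"
        by (metis in_set_conv_nth)
      \<comment> \<open>Iterating the cycle n times rotates its list by n places, so every entry is
        reached from the head.\<close>
      have "(?c ^^ n) (hd cs) = hd (rotate n cs)"
        using cyclic_rotation[OF assms(2), of n] assms(1) by (metis hd_map)
      also have "\<dots> = x"
        using n assms(1) by (simp add: hd_rotate_conv_nth)
      finally show "x \<in> orbit ?c (hd cs)"
        unfolding orbit_altdef_permutation[OF permutation_of_cycle] by blast
    qed
  qed
qed

text \<open>Induction on the cycles: a further disjoint cycle of length k adds one orbit, and its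
  sign -(-1)^k times the -1 for that orbit is (-1)^k. Finiteness and \<open>p permutes S\<close> are
  carried along for the induction step.\<close>

lemma cycle_decomp_sign:
  assumes "cycle_decomp S p"
  shows "finite S \<and> p permutes S \<and> sign p * (-1) ^ card (orbit p ` S) = (-1) ^ card S"
  using assms
proof induction
  case empty
  then show ?case
    by simp (simp add: id_def)
next
  case (comp I p cs)
  let ?c = "cycle_of_list cs"
  have I: "finite I" "p permutes I" "sign p * (-1) ^ card (orbit p ` I) = (-1) ^ card I"
    using comp.IH by auto
  show ?case
  \<comment> \<open>A \<open>cycle\<close> is only a distinct list, so the empty one is allowed; it
    adds no orbit.\<close>
  proof (cases "cs = []")
    case True
    with I show ?thesis
      by simp
  next
    case False
    have perm: "?c \<circ> p permutes set cs \<union> I"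
      by (intro permutes_compose permutes_subset[OF cycle_permutes] permutes_subset[OF I(2)]) auto
    \<comment> \<open>\<open>p\<close> fixes \<open>set cs\<close> pointwise, so these points form
      one new orbit.\<close>
    have "cyclic_on (?c \<circ> p) (set cs)"
      using permutes_comp_preserves_cyclic1[OF I(2) cyclic_on_cycle_of_list[OF False comp.hyps(2)]
          comp.hyps(3)] by simp
    then have "orbit (?c \<circ> p) ` set cs = {set cs}"
      using False by (simp add: cyclic_on_alldef image_constant_conv)
    moreover have "orbit (?c \<circ> p) ` I = orbit p ` I"
    proof (rule image_cong)
      fix x assume "x \<in> I"
      \<comment> \<open>\<open>?c\<close> fixes \<open>I\<close> pointwise, so
        \<open>orbit p x\<close> stays cyclic for the composition; as it contains \<open>x\<close>,
        it is the orbit of \<open>x\<close>.\<close>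
      show "orbit (?c \<circ> p) x = orbit p x"
        using permutes_comp_preserves_cyclic2[OF cycle_permutes cyclic_on_orbit[OF I(2,1)]
            comp.hyps(3) permutes_orbit_subset[OF I(2) \<open>x \<in> I\<close>]]
          permutation_self_in_orbit[of p x] I(1,2)
        by (intro orbit_cyclic_eq3) (auto simp: permutation_permutes)
    qed simp
    ultimately have "orbit (?c \<circ> p) ` (set cs \<union> I) = insert (set cs) (orbit p ` I)"
      by (simp add: image_Un)
    moreover have "set cs \<notin> orbit p ` I"
      using False comp.hyps(3) permutes_orbit_subset[OF I(2)]
      by (metis image_iff inf.absorb1 set_empty)
    ultimately have "card (orbit (?c \<circ> p) ` (set cs \<union> I)) = Suc (card (orbit p ` I))"
      using I(1) by simp
    moreover have "sign (?c \<circ> p) = - ((-1) ^ length cs) * sign p"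
      using sign_compose[OF permutation_of_cycle permutes_imp_permutation[OF I(1,2)]]
        sign_cycle_of_list[OF False comp.hyps(2)] by metis
    moreover have "card (set cs \<union> I) = length cs + card I"
      using I(1) comp.hyps(2,3) by (simp add: card_Un_disjoint distinct_card)
    ultimately show ?thesis
      using I perm by (simp add: comp_def power_add mult.assoc)
  qed
qed

lemma sign_times_orbits:
  assumes "p permutes S" "finite S"
  shows "sign p * (-1) ^ card (orbit p ` S) = (-1) ^ card S"
  using cycle_decomp_sign cycle_decomposition[OF assms] by blast

text \<open>The orbits partition \<open>S\<close>: they cover it, and two that meet
  coincide.\<close>

lemma prod_orbits:
  assumes "p permutes S" "finite S"
  shows "(\<Prod>\<gamma>\<in>orbit p ` S. \<Prod>i\<in>\<gamma>. h i) = (\<Prod>i\<in>S. h i)"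
proof -
  have perm: "permutation p"
    using assms by (auto intro: permutes_imp_permutation)
  have "\<Union> (orbit p ` S) = S"
    using permutes_orbit_subset[OF assms(1)] permutation_self_in_orbit[OF perm] by blast
  moreover have "orbit p x = orbit p y" if "z \<in> orbit p x" "z \<in> orbit p y" for x y z
    using that orbit_cyclic_eq3[OF cyclic_on_orbit'[OF perm]] by metis
  then have "\<forall>A\<in>orbit p ` S. \<forall>B\<in>orbit p ` S. A \<noteq> B \<longrightarrow> A \<inter> B = {}"
    by blast
  moreover have "\<forall>A\<in>orbit p ` S. finite A"
    by (auto intro: finite_orbit permutation_self_in_orbit[OF perm])
  ultimately show ?thesis
    using prod.Union_disjoint[of "orbit p ` S" h] by simp
qed

interpretation scaleC: vector_space "scaleC :: complex \<Rightarrow> 'a::complex_comm_algebra \<Rightarrow> 'a"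
  by (rule vector_space_scaleC)

lemma mult_scaleC_right:
  fixes x y :: "'a::complex_comm_algebra"
  shows "x * (c *\<^sub>C y) = c *\<^sub>C (x * y)"
  by (metis mult.commute mult_scaleC_left)

lemma prod_scaleC:
  fixes h :: "'i \<Rightarrow> 'a::complex_comm_algebra"
  shows "finite S \<Longrightarrow> (\<Prod>i\<in>S. c *\<^sub>C h i) = c ^ card S *\<^sub>C (\<Prod>i\<in>S. h i)"
  by (induction S rule: finite_induct)
    (simp_all add: mult_scaleC_left mult_scaleC_right mult.commute)

lemma Phi_eq_if_minus_on_ideal:
  fixes g :: "'a::complex_comm_algebra \<Rightarrow> 'a"
  assumes "\<And>x. g (b * x) = - (b * x)"
  shows "Phi n g (\<lambda>_. b) = (fact n * (-1) ^ n) *\<^sub>C b ^ n"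
proof -
  \<comment> \<open>Only positive powers of \<open>b\<close> are sure to lie in its ideal; orbits,
    being nonempty, give such powers.\<close>
  have g: "g (b ^ k) = (-1) *\<^sub>C b ^ k" if "k > 0" for k
    using assms[of "b ^ (k - 1)"] that by (cases k) simp_all
  have "of_int (sign \<sigma>) *\<^sub>C (\<Prod>\<gamma>\<in>cycle_supports n \<sigma>. g (\<Prod>i\<in>\<gamma>. b)) = (-1) ^ n *\<^sub>C b ^ n"
    if \<sigma>: "\<sigma> permutes {1..n}" for \<sigma>
  proof -
    have perm: "permutation \<sigma>"
      using \<sigma> by (auto intro: permutes_imp_permutation)
    have "card \<gamma> > 0" if "\<gamma> \<in> orbit \<sigma> ` {1..n}" for \<gamma>
      using that
      by (auto simp: card_gt_0_iff orbit_nonempty finite_orbit permutation_self_in_orbit[OF perm])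
    then have "(\<Prod>\<gamma>\<in>orbit \<sigma> ` {1..n}. g (\<Prod>i\<in>\<gamma>. b)) =
        (\<Prod>\<gamma>\<in>orbit \<sigma> ` {1..n}. (-1) *\<^sub>C (\<Prod>i\<in>\<gamma>. b))"
      by (intro prod.cong) (simp_all add: g del: scaleC.scale_minus_left)
    also have "\<dots> = (-1) ^ card (orbit \<sigma> ` {1..n}) *\<^sub>C b ^ n"
      using prod_orbits[OF \<sigma>, of "\<lambda>_. b"] by (subst prod_scaleC) simp_all
    finally have "of_int (sign \<sigma>) *\<^sub>C (\<Prod>\<gamma>\<in>cycle_supports n \<sigma>. g (\<Prod>i\<in>\<gamma>. b)) =
        of_int (sign \<sigma> * (-1) ^ card (orbit \<sigma> ` {1..n})) *\<^sub>C b ^ n"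
      by (simp add: cycle_supports_def)
    \<comment> \<open>The scalar no longer depends on \<sigma>.\<close>
    then show ?thesis
      unfolding sign_times_orbits[OF \<sigma> finite_atLeastAtMost] by simp
  qed
  then have "Phi n g (\<lambda>_. b) = (\<Sum>\<sigma> | \<sigma> permutes {1..n}. (-1) ^ n *\<^sub>C b ^ n)"
    unfolding Phi_def by (intro sum.cong) simp_all
  also have "\<dots> = (\<Sum>\<sigma> | \<sigma> permutes {1..n}. (-1) ^ n) *\<^sub>C b ^ n"
    by (simp only: scaleC.scale_sum_left)
  also have "(\<Sum>\<sigma> | \<sigma> permutes {1..n}. (-1) ^ n) = (fact n * (-1) ^ n :: complex)"
    using card_permutations[of "{1..n}" n] by simp
  finally show ?thesis .
qed

theorem theorem4p6:
  fixes f :: "'a::complex_comm_algebra \<Rightarrow> 'b::complex_comm_algebra"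
    and \<tau> :: "'b \<Rightarrow> 'a"
    and n :: nat
  assumes "\<And>x :: 'a. nilpotent x \<Longrightarrow> x = 0"
    and "\<And>y :: 'b. nilpotent y \<Longrightarrow> y = 0"
    and "ring_homomorphism f"
    and "n_transfer n f \<tau>"
  shows "frobenius_kernel \<tau> = {0}"
proof -
  obtain g :: "'b \<Rightarrow> 'b" where
    \<tau>: "complex_linear \<tau>" and
    g: "frobenius_hom (n - 1) g" and
    f\<tau>: "\<And>b. f (\<tau> b) = b + g b"
    using assms(4) unfolding n_transfer_def frobenius_hom_def by blast
  have "f 0 + f 0 = f 0 + 0"
    using assms(3) unfolding ring_homomorphism_def by (metis add.right_neutral)
  then have "f 0 = 0"
    by simp
  have "b = 0" if "b \<in> frobenius_kernel \<tau>" for b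
  \<comment> \<open>As the domain of \<tau> is reduced, nilpotency of \<open>b\<close>
    suffices.\<close>
  proof (rule assms(2))
    have "b * x + g (b * x) = 0" for x
      using that f\<tau>[of "b * x"] \<open>f 0 = 0\<close> by (simp add: frobenius_kernel_def)
    then have "g (b * x) = - (b * x)" for x
      by (metis add.inverse_unique)
    \<comment> \<open>The Frobenius condition on \<open>g\<close> is evaluated on the diagonal, with
      the index in the form in which \<open>frobenius_hom (n - 1) g\<close> supplies it.\<close>
    moreover have "Phi (n - 1 + 1) g (\<lambda>_. b) = 0"
      using g unfolding frobenius_hom_def by blast
    \<comment> \<open>Characteristic zero enters here: the factorial can be cancelled.\<close>
    moreover have "fact (n - 1 + 1) * (-1) ^ (n - 1 + 1) \<noteq> (0 :: complex)"
      by (simp only: mult_eq_0_iff fact_nonzero power_eq_0_iff) simp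
    ultimately have "b ^ (n - 1 + 1) = 0"
      using Phi_eq_if_minus_on_ideal[of g b "n - 1 + 1"] scaleC.scale_eq_0_iff by metis
    then show "nilpotent b"
      unfolding nilpotent_def by blast
  qed
  moreover have "\<tau> 0 = 0"
    using module_hom.zero[of scaleC scaleC \<tau>] \<tau> by (simp add: module_hom_iff_linear)
  then have "0 \<in> frobenius_kernel \<tau>"
    by (simp add: frobenius_kernel_def)
  ultimately show ?thesis
    by blast
qed

end
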